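(* Let $\mathcal{L}$ be a directed family of subsets of $\mathbb{N}_0$ such that $\Delta(\mathcal{L})$ is finite and non-empty, and set $\delta = \min \Delta(\mathcal{L})$. (1) Let $l \in \mathbb{N}_0$ be such that $\{l, l+\delta\} \subseteq L$ for some $L \in \mathcal{L}$. Then $q = \frac{1}{\delta}\max \Delta(\mathcal{L})$ is a non-negative integer and the following statements are equivalent: (a) $\mathcal{L}$ satisfies the Structure Theorem for Unions. (b) There exists $M \in \mathbb{N}_0$ such that $\mathcal{U}_k(\mathcal{L}) \cap [\![ \rho_{k-lq}(\mathcal{L}) + lq,\ \rho_k(\mathcal{L}) - M ]\!]$ is either empty or an AP with difference $\delta$ for all sufficiently large $k \in \mathbb{N}$. (2) Assume that $\rho(\mathcal{L}) < \infty$ and there exists $L^\ast \in \mathcal{L}$ such that $\rho(L^\ast) = \rho(\mathcal{L})$ and $L^\ast$ is an AP with difference $\delta$. Then $\mathcal{U}_k(\mathcal{L})$ is an AP with difference $\delta$ for all sufficiently large $k$.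
   Context: $\mathbb{N}$ is the set of positive integers, $\mathbb{N}_0 = \mathbb{N}\cup\{0\}$. For $a,b \in \mathbb{R}\cup\{\pm\infty\}$, $[\![a,b]\!] = \{x \in \mathbb{Z} : a \le x \le b\}$. Conventions: $\inf\emptyset = \infty$, $\sup\emptyset = 0$. For $L \subseteq \mathbb{N}_0$ let $L^+ = L \cap \mathbb{N}$. The elasticity of $L$ is $\rho(L) = \sup L^+/\min L^+$ if $L^+ \neq \emptyset$ and $\rho(L) = 1$ otherwise. A distance of $L$ is a $d \in \mathbb{N}$ for which there are $k, \ell \in L$ with $\ell - k = d$ and $L \cap [\![k,\ell]\!] = \{k,\ell\}$; $\Delta(L)$ is the set of distances of $L$. $L$ is an AP (arithmetical progression) with difference $d\in\mathbb{N}$ if $L \ne \emptyset$ and $\Delta(L) \subseteq \{d\}$. For $d \in \mathbb{N}$, $M \in \mathbb{N}_0$, $L$ is an AAP (almost arithmetical progression) with difference $d$ and bound $M$ if $L \subseteq y + d\mathbb{Z}$ for some $y \in \mathbb{Z}$ and $L \cap [\![\inf L + M, \sup L - M]\!]$ is an AP with difference $d$. For a family $\mathcal{L}$ of subsets of $\mathbb{N}_0$ and $k \in \mathbb{N}_0$: $\mathcal{L}_k = \{L \in \mathcal{L} : k \in L\}$, $\mathcal{U}_k(\mathcal{L}) = \bigcup_{L \in \mathcal{L}_k} L$, $\lambda_k(\mathcal{L}) = \inf \mathcal{U}_k(\mathcal{L})$, $\rho_k(\mathcal{L}) = \sup \mathcal{U}_k(\mathcal{L})$, $\rho(\mathcal{L})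 = \sup\{\rho(L) : L \in \mathcal{L}\}$, $\Delta(\mathcal{L}) = \bigcup_{L \in \mathcal{L}} \Delta(L)$. The family $\mathcal{L}$ is directed if $1 \in L$ for some $L \in \mathcal{L}$ and for all $L_1, L_2 \in \mathcal{L}$ there is $L' \in \mathcal{L}$ with $L_1 + L_2 \subseteq L'$ (sumset). $\mathcal{L}$ satisfies the Structure Theorem for Unions if there are $d \in \mathbb{N}$ and $M \in \mathbb{N}_0$ such that $\mathcal{U}_k(\mathcal{L})$ is an AAP with difference $d$ and bound $M$ for all sufficiently large $k \in \mathbb{N}$. *)

theory Defs
  imports
    Complex_Main
    "HOL-Library.Set_Algebras"
    "HOL-Library.Extended_Nat"
    "HOL-Library.Extended_Real"
    "HOL-Library.Extended_Nonnegative_Real"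
begin

text \<open>
  Suprema and infima of sets of natural numbers are taken in \<^typ>\<open>enat\<close>, and
  elasticities in \<^typ>\<open>ennreal\<close>: in both types \<open>Sup {} = 0\<close> and \<open>Inf {} = \<infinity>\<close>,
  which are the conventions in force here (in \<^typ>\<open>ereal\<close> one has \<open>Sup {} = -\<infinity>\<close>).
  Interval endpoints, which may be negative, are computed in \<^typ>\<open>ereal\<close>.
\<close>

definition int_ivl :: "ereal \<Rightarrow> ereal \<Rightarrow> int set" where
  "int_ivl a b = {x. a \<le> ereal (real_of_int x) \<and> ereal (real_of_int x) \<le> b}"

definition sup_set :: "nat set \<Rightarrow> enat" where
  "sup_set L = (SUP n\<in>L. enat n)"

definition inf_set :: "nat set \<Rightarrow> enat" where
  "inf_set L = (INF n\<in>L. enat n)"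

definition pos_part :: "nat set \<Rightarrow> nat set" where
  "pos_part L = L \<inter> {0<..}"

definition elasticity :: "nat set \<Rightarrow> ennreal" where
  "elasticity L =
     (if pos_part L \<noteq> {}
      then (SUP n\<in>pos_part L. of_nat n) / of_nat (LEAST n. n \<in> pos_part L)
      else 1)"

definition distances :: "nat set \<Rightarrow> nat set" where
  "distances L = {d. 0 < d \<and> (\<exists>k\<in>L. \<exists>l\<in>L. int l - int k = int d \<and> L \<inter> {k..l} = {k, l})}"

definition is_AP :: "nat \<Rightarrow> nat set \<Rightarrow> bool" where
  "is_AP d L \<longleftrightarrow> 0 < d \<and> L \<noteq> {} \<and> distances L \<subseteq> {d}"

definition is_AAP :: "nat \<Rightarrow> nat \<Rightarrow> nat set \<Rightarrow> bool" where
  "is_AAP d M L \<longleftrightarrow>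
     0 < d \<and>
     (\<exists>y::int. int ` L \<subseteq> {y + int d * z |z. True}) \<and>
     is_AP d (L \<inter> int -` int_ivl (ereal_of_enat (inf_set L) + ereal (real M))
                                  (ereal_of_enat (sup_set L) - ereal (real M)))"

definition fam_at :: "nat set set \<Rightarrow> nat \<Rightarrow> nat set set" where
  "fam_at \<L> k = {L \<in> \<L>. k \<in> L}"

definition fam_union :: "nat set set \<Rightarrow> nat \<Rightarrow> nat set" where
  "fam_union \<L> k = \<Union> (fam_at \<L> k)"

definition fam_rho_at :: "nat set set \<Rightarrow> nat \<Rightarrow> enat" where
  "fam_rho_at \<L> k = sup_set (fam_union \<L> k)"

definition fam_elasticity :: "nat set set \<Rightarrow> ennreal" where
  "fam_elasticity \<L> = (SUP L\<in>\<L>. elasticity L)"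

definition fam_distances :: "nat set set \<Rightarrow> nat set" where
  "fam_distances \<L> = (\<Union>L\<in>\<L>. distances L)"

text \<open>Here \<open>L1 + L2\<close> is the sumset.\<close>

definition directed_family :: "nat set set \<Rightarrow> bool" where
  "directed_family \<L> \<longleftrightarrow>
     (\<exists>L\<in>\<L>. 1 \<in> L) \<and> (\<forall>L1\<in>\<L>. \<forall>L2\<in>\<L>. \<exists>L'\<in>\<L>. L1 + L2 \<subseteq> L')"

definition structure_theorem_for_unions :: "nat set set \<Rightarrow> bool" where
  "structure_theorem_for_unions \<L> \<longleftrightarrow>
     (\<exists>d M. 0 < d \<and> (\<forall>\<^sub>F k in sequentially. is_AAP d M (fam_union \<L> k)))"

end

theory Submission
  imports Defs
begin

text \<open>
  All gaps of \<open>U k\<close> (the union of the members containing \<open>k\<close>) are multiples of \<open>\<delta>\<close>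
  and at most \<open>q \<delta>\<close>, where \<open>q \<delta>\<close> is the maximal distance. Adding \<open>q\<close> copies of a member
  that contains \<open>l\<close> and \<open>l + \<delta>\<close> to the members containing \<open>k - l q\<close> therefore fills
  \<open>U k\<close> between \<open>\<lambda>\<^sub>k\<^sub>-\<^sub>l\<^sub>q + l q\<close> and \<open>\<rho>\<^sub>k\<^sub>-\<^sub>l\<^sub>q + l q\<close>. The lower end stays within
  bounded distance of \<open>\<lambda>\<^sub>k\<close>, so only the upper end can obstruct the Structure Theorem.

  If a progression from \<open>a\<close> to \<open>b\<close> attains the elasticity \<open>b / a\<close>, then the deviations
  \<open>b k - a \<rho>\<^sub>k\<close> and \<open>b \<lambda>\<^sub>k - a k\<close> are non-negative and do not increase under \<open>k \<mapsto> k + a\<close>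
  and \<open>k \<mapsto> k + b\<close>, respectively. Hence eventually \<open>\<rho>\<^sub>k\<^sub>+\<^sub>a = \<rho>\<^sub>k + b\<close> and
  \<open>\<lambda>\<^sub>k\<^sub>+\<^sub>b = \<lambda>\<^sub>k + a\<close>, and the same filling argument covers \<open>U k\<close> up to both of its ends.
\<close>

section \<open>Sets of natural numbers\<close>

lemma mod_eq_iff_dvd_diff:
  fixes x y d :: nat
  assumes "x \<le> y"
  shows "x mod d = y mod d \<longleftrightarrow> d dvd y - x"
  using mod_eq_dvd_iff_nat[OF assms, of d] by (metis (no_types))

text \<open>The least element of \<open>L\<close> above \<open>x\<close> works; well-ordering
  supplies it even when \<open>L\<close> is infinite.\<close>

lemma distance_after:
  assumes "x \<in> L" "y \<in> L" "x < y"
  shows "\<exists>x'\<in>L. x < x' \<and> x' \<le> y \<and> x' - x \<in> distances L"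
proof -
  define x' where "x' = (LEAST z. z \<in> L \<and> x < z)"
  have x': "x' \<in> L" "x < x'"
    using LeastI[of "\<lambda>z. z \<in> L \<and> x < z" y] assms unfolding x'_def by auto
  have least: "x' \<le> z" if "z \<in> L" "x < z" for z
    using that Least_le[of "\<lambda>z. z \<in> L \<and> x < z" z] unfolding x'_def by auto
  have "L \<inter> {x..x'} = {x, x'}"
  proof (intro equalityI subsetI)
    fix z assume z: "z \<in> L \<inter> {x..x'}"
    then show "z \<in> {x, x'}" using least[of z] by (cases "z = x") auto
  qed (use assms x' in auto)
  then have "x' - x \<in> distances L"
    using x' assms unfolding distances_def
    by (intro CollectI conjI bexI[of _ x] bexI[of _ x']) (simp_all add: of_nat_diff)
  with x' least[of y] assms show ?thesis by blast
qed

text \<open>Replaces the set of distances by a closure rule that is checked on one pair of elements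
  at a time.\<close>

lemma is_AP_iff:
  "is_AP d L \<longleftrightarrow> 0 < d \<and> L \<noteq> {} \<and> (\<forall>x\<in>L. \<forall>y\<in>L. x < y \<longrightarrow> x + d \<in> L \<and> x + d \<le> y)"
proof
  assume ap: "is_AP d L"
  have "x + d \<in> L \<and> x + d \<le> y" if xy: "x \<in> L" "y \<in> L" "x < y" for x y
  proof -
    obtain x' where x': "x' \<in> L" "x < x'" "x' \<le> y" "x' - x \<in> distances L"
      using distance_after[OF xy] by blast
    then have "x' = x + d" using ap unfolding is_AP_def by fastforce
    with x' show ?thesis by simp
  qed
  with ap show "0 < d \<and> L \<noteq> {} \<and> (\<forall>x\<in>L. \<forall>y\<in>L. x < y \<longrightarrow> x + d \<in> L \<and> x + d \<le> y)"
    unfolding is_AP_def by blast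
next
  assume R: "0 < d \<and> L \<noteq> {} \<and> (\<forall>x\<in>L. \<forall>y\<in>L. x < y \<longrightarrow> x + d \<in> L \<and> x + d \<le> y)"
  have "e = d" if "e \<in> distances L" for e
  proof -
    from that obtain k l where kl: "k \<in> L" "l \<in> L" "0 < e" "int l - int k = int e"
        "L \<inter> {k..l} = {k, l}"
      unfolding distances_def by blast
    then have l: "l = k + e" by linarith
    with kl have "k < l" by simp
    with R kl have "k + d \<in> L" "k + d \<le> l" by blast+
    then have "k + d \<in> L \<inter> {k..l}" by simp
    then have "k + d \<in> {k, l}" unfolding kl(5) .
    moreover have "0 < d" using R by blast
    ultimately show ?thesis using l by simp
  qed
  with R show "is_AP d L" unfolding is_AP_def by blast
qed

lemma is_AP_step:
  assumes "is_AP d L" "x \<in> L" "y \<in> L" "x < y"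
  shows "x + d \<in> L" "x + d \<le> y"
  using assms unfolding is_AP_iff by blast+

text \<open>Only elements with a larger element of \<open>S\<close> are constrained, so
  \<open>S\<close> may have a maximum.\<close>

definition gaps_le :: "nat \<Rightarrow> nat set \<Rightarrow> bool" where
  "gaps_le m S \<longleftrightarrow> (\<forall>w\<in>S. \<forall>v\<in>S. w < v \<longrightarrow> (\<exists>w'\<in>S. w < w' \<and> w' \<le> w + m))"

text \<open>The largest element of \<open>S\<close> up to \<open>z\<close> works, since otherwise a
  gap longer than \<open>m\<close> would follow it. The slack in \<open>z \<le> v + m\<close> admits
  targets beyond \<open>v\<close>, which a progression added to \<open>S\<close> still
  reaches.\<close>

lemma gaps_le_cover:
  assumes gaps: "gaps_le m S" and "u \<in> S" "v \<in> S" "u \<le> z" "z \<le> v + m"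
  shows "\<exists>w\<in>S. w \<le> z \<and> z \<le> w + m"
proof -
  define w where "w = Max (S \<inter> {..z})"
  have fin: "finite (S \<inter> {..z})" by simp
  have "w \<in> S \<inter> {..z}" unfolding w_def using assms by (intro Max_in) auto
  then have w: "w \<in> S" "w \<le> z" by auto
  have max: "t \<le> w" if "t \<in> S" "t \<le> z" for t
    using that Max_ge[OF fin] unfolding w_def by auto
  have "z \<le> w + m"
  proof (rule ccontr)
    assume "\<not> z \<le> w + m"
    then have "w < v" using assms by linarith
    then obtain w' where "w' \<in> S" "w < w'" "w' \<le> w + m"
      using gaps w assms unfolding gaps_le_def by blast
    with max[of w'] \<open>\<not> z \<le> w + m\<close> show False by auto
  qed
  with w show ?thesis by blast
qed

lemma gaps_le_mono: "gaps_le m S \<Longrightarrow> m \<le> n \<Longrightarrow> gaps_le n S"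
  unfolding gaps_le_def by (meson add_left_mono le_trans)

section \<open>Interval endpoints and almost arithmetical progressions\<close>

lemma le_sup_set_iff:
  assumes "S \<noteq> {}"
  shows "enat x \<le> sup_set S \<longleftrightarrow> (\<exists>v\<in>S. x \<le> v)"
proof (cases x)
  case 0
  with assms show ?thesis by (auto simp: zero_enat_def[symmetric])
next
  case (Suc n)
  \<comment> \<open>A strict inequality below a supremum is witnessed by a member, so
    \<open>x = Suc n\<close> is traded for \<open>n\<close>.\<close>
  have "enat x \<le> sup_set S \<longleftrightarrow> enat n < sup_set S"
    using Suc by (metis Suc_ile_eq)
  also have "\<dots> \<longleftrightarrow> (\<exists>v\<in>S. n < v)" unfolding sup_set_def less_SUP_iff by simp
  finally show ?thesis using Suc by (simp add: Suc_le_eq)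
qed

lemma sup_set_add_le_iff:
  assumes "S \<noteq> {}"
  shows "sup_set S + enat m \<le> enat x \<longleftrightarrow> (\<forall>v\<in>S. v + m \<le> x)"
proof -
  have "sup_set S + enat m \<le> enat x \<longleftrightarrow> m \<le> x \<and> sup_set S \<le> enat (x - m)"
    by (cases "sup_set S") auto
  also have "\<dots> \<longleftrightarrow> m \<le> x \<and> (\<forall>v\<in>S. v \<le> x - m)"
    unfolding sup_set_def SUP_le_iff by simp
  also have "\<dots> \<longleftrightarrow> (\<forall>v\<in>S. v + m \<le> x)" using assms by force
  finally show ?thesis .
qed

lemma inf_set_add_le_iff:
  "inf_set S + enat m \<le> enat x \<longleftrightarrow> (\<exists>u\<in>S. u + m \<le> x)"
proof -
  have "inf_set S + enat m \<le> enat x \<longleftrightarrow> m \<le> x \<and> inf_set S < enat (Suc (x - m))"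
    by (cases "inf_set S") auto
  also have "\<dots> \<longleftrightarrow> m \<le> x \<and> (\<exists>u\<in>S. u < Suc (x - m))"
    unfolding inf_set_def INF_less_iff by simp
  also have "\<dots> \<longleftrightarrow> (\<exists>u\<in>S. u + m \<le> x)"
  proof -
    have "m \<le> x \<and> u < Suc (x - m) \<longleftrightarrow> u + m \<le> x" for u by linarith
    then show ?thesis by blast
  qed
  finally show ?thesis .
qed

text \<open>Moving the subtraction across removes \<open>ereal\<close> arithmetic and with it the
  case of infinite endpoints.\<close>

lemma int_mem_int_ivl_iff:
  "int x \<in> int_ivl (ereal_of_enat A + ereal (real m)) (ereal_of_enat B - ereal (real n))
     \<longleftrightarrow> A + enat m \<le> enat x \<and> enat (x + n) \<le> B"
  by (cases A; cases B) (auto simp: int_ivl_def)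

text \<open>Witnesses \<open>u\<close> and \<open>v\<close> in place of infimum and supremum also
  cover an unbounded \<open>S\<close>, which is not trimmed above.\<close>

lemma is_AAP_iff:
  assumes "S \<noteq> {}"
  shows "is_AAP d m S \<longleftrightarrow> 0 < d \<and> (\<exists>y::int. int ` S \<subseteq> {y + int d * z |z. True}) \<and>
    is_AP d {x\<in>S. (\<exists>u\<in>S. u + m \<le> x) \<and> (\<exists>v\<in>S. x + m \<le> v)}"
proof -
  have "S \<inter> int -` int_ivl (ereal_of_enat (inf_set S) + ereal (real m))
           (ereal_of_enat (sup_set S) - ereal (real m))
      = {x\<in>S. (\<exists>u\<in>S. u + m \<le> x) \<and> (\<exists>v\<in>S. x + m \<le> v)}"
    by (auto simp: int_mem_int_ivl_iff inf_set_add_le_iff le_sup_set_iff[OF assms])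
  then show ?thesis unfolding is_AAP_def by simp
qed

section \<open>Elasticity of a single set\<close>

lemma elasticity_ge:
  assumes "x \<in> L" "y \<in> L" "0 < x"
  shows "of_nat y / of_nat x \<le> elasticity L"
proof -
  have x: "x \<in> pos_part L" using assms unfolding pos_part_def by auto
  have "(of_nat y :: ennreal) \<le> (SUP n\<in>pos_part L. of_nat n)"
    \<comment> \<open>The value \<open>y = 0\<close> lies outside \<open>pos_part L\<close>, hence
      the separate case.\<close>
    by (cases "y = 0") (use assms in \<open>auto simp: pos_part_def intro!: SUP_upper\<close>)
  moreover have "inverse (of_nat x :: ennreal) \<le> inverse (of_nat (LEAST n. n \<in> pos_part L))"
  proof -
    have "(LEAST n. n \<in> pos_part L) \<le> x" using x by (rule Least_le)
    moreover have "0 < (LEAST n. n \<in> pos_part L)"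
      using LeastI[of "\<lambda>n. n \<in> pos_part L", OF x] unfolding pos_part_def by simp
    ultimately show ?thesis
      by (simp add: ennreal_of_nat_eq_real_of_nat inverse_ennreal ennreal_leI le_imp_inverse_le)
  qed
  ultimately have "of_nat y / of_nat x \<le>
      (SUP n\<in>pos_part L. of_nat n :: ennreal) / of_nat (LEAST n. n \<in> pos_part L)"
    unfolding divide_ennreal_def by (intro mult_mono) auto
  with x show ?thesis unfolding elasticity_def by auto
qed

lemma ennreal_of_nat_divide_le_iff:
  assumes "0 < x" "0 < a"
  shows "(of_nat y / of_nat x :: ennreal) \<le> of_nat b / of_nat a \<longleftrightarrow> y * a \<le> b * x"
proof -
  have "(of_nat y / of_nat x :: ennreal) \<le> of_nat b / of_nat a
      \<longleftrightarrow> real y / real x \<le> real b / real a"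
    using assms by (simp add: ennreal_of_nat_eq_real_of_nat divide_ennreal)
  also have "\<dots> \<longleftrightarrow> real (y * a) \<le> real (b * x)" using assms by (simp add: field_simps)
  finally show ?thesis by (simp only: of_nat_le_iff)
qed

text \<open>A finite quotient forces a finite supremum, hence a finite positive part, whose minimum
  and maximum serve as \<open>a\<close> and \<open>b\<close>.\<close>

lemma elasticity_finite_obtain:
  assumes "elasticity L < \<infinity>" "pos_part L \<noteq> {}"
  obtains a b where "a \<in> L" "b \<in> L" "0 < a" "elasticity L = of_nat b / of_nat a"
proof -
  let ?P = "pos_part L"
  define a where "a = (LEAST n. n \<in> ?P)"
  have a: "a \<in> ?P" using assms unfolding a_def by (metis LeastI_ex ex_in_conv)
  have el: "elasticity L = (SUP n\<in>?P. of_nat n) / of_nat a"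
    using assms unfolding elasticity_def a_def by simp
  have a0: "0 < a" using a unfolding pos_part_def by simp
  have "(SUP n\<in>?P. of_nat n :: ennreal) \<noteq> \<infinity>"
  proof
    assume "(SUP n\<in>?P. of_nat n :: ennreal) = \<infinity>"
    with el have "elasticity L = \<infinity> / of_nat a" by simp
    with assms show False by (simp add: ennreal_top_divide)
  qed
  then obtain N where N: "(SUP n\<in>?P. of_nat n :: ennreal) < of_nat N"
    by (metis ennreal_Ex_less_of_nat infinity_ennreal_def less_top)
  have "n < N" if "n \<in> ?P" for n
  proof -
    have "(of_nat n :: ennreal) \<le> (SUP n\<in>?P. of_nat n)" using that by (rule SUP_upper)
    also note N
    finally have "(of_nat n :: ennreal) < of_nat N" .
    then show ?thesis by (simp add: of_nat_less_iff)
  qed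
  then have fin: "finite ?P" by (meson bounded_nat_set_is_finite)
  define b where "b = Max ?P"
  have b: "b \<in> ?P" "\<And>n. n \<in> ?P \<Longrightarrow> n \<le> b" using fin assms unfolding b_def by auto
  have "(SUP n\<in>?P. of_nat n :: ennreal) = of_nat b"
    by (rule antisym) (use b in \<open>auto intro!: SUP_least SUP_upper\<close>)
  with el a a0 b that show ?thesis unfolding pos_part_def by auto
qed

text \<open>The sums of \<open>f\<close> over windows of length \<open>p\<close> are non-increasing, hence eventually constant.\<close>

lemma eventually_periodic:
  fixes f :: "nat \<Rightarrow> nat"
  assumes "\<And>k. 1 \<le> k \<Longrightarrow> f (k + p) \<le> f k"
  shows "\<forall>\<^sub>F k in sequentially. f (k + p) = f k"
proof -
  define F where "F k = (\<Sum>j<p. f (k + j))" for k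
  have F: "F (Suc k) + f k = F k + f (k + p)" for k
    using sum.lessThan_Suc_shift[of "\<lambda>j. f (k + j)" p] unfolding F_def by simp
  \<comment> \<open>From a minimiser \<open>k0\<close> on, \<open>F\<close> can neither rise nor
    fall, and by \<open>F\<close> its increment is \<open>f (k + p) - f k\<close>.\<close>
  obtain k0 where k0: "1 \<le> k0" "\<And>k. 1 \<le> k \<Longrightarrow> F k0 \<le> F k"
    using ex_has_least_nat[of "\<lambda>k. 1 \<le> k" 1 F] by auto
  have le: "F k \<le> F k0" if "k0 \<le> k" for k
    using that
  proof (induction k rule: dec_induct)
    case (step n)
    then show ?case using F[of n] assms[of n] k0(1) by linarith
  qed simp
  have "f (k + p) = f k" if "k0 \<le> k" for k
    using le[of k] le[of "Suc k"] k0(2)[of k] k0(2)[of "Suc k"] F[of k] k0(1) that by linarith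
  then show ?thesis unfolding eventually_sequentially by blast
qed

section \<open>Unions in a directed family with finitely many distances\<close>

locale directed_family_finite_distances =
  fixes \<L> :: "nat set set" and \<delta> :: nat
  assumes directed: "directed_family \<L>"
    and finite_distances: "finite (fam_distances \<L>)"
    and distances_nonempty: "fam_distances \<L> \<noteq> {}"
    and delta_def: "\<delta> = Min (fam_distances \<L>)"
begin

abbreviation U :: "nat \<Rightarrow> nat set" where
  "U \<equiv> fam_union \<L>"

text \<open>The progression only has to lie inside a member, so it survives the passage to a larger
  member that directedness entails.\<close>

definition ladder :: "nat \<Rightarrow> nat \<Rightarrow> bool" where
  "ladder a s \<longleftrightarrow> (\<exists>L\<in>\<L>. \<forall>i\<le>s. a + i * \<delta> \<in> L)"

lemma mem_U_iff: "x \<in> U k \<longleftrightarrow> (\<exists>L\<in>\<L>. k \<in> L \<and> x \<in> L)"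
  unfolding fam_union_def fam_at_def by blast

lemma U_sym: "x \<in> U k \<longleftrightarrow> k \<in> U x"
  unfolding mem_U_iff by blast

lemma directed_sum:
  assumes "L1 \<in> \<L>" "L2 \<in> \<L>"
  obtains L where "L \<in> \<L>" "\<And>x y. x \<in> L1 \<Longrightarrow> y \<in> L2 \<Longrightarrow> x + y \<in> L"
proof -
  obtain L where L: "L \<in> \<L>" "L1 + L2 \<subseteq> L"
    using directed assms unfolding directed_family_def by blast
  then have "x + y \<in> L" if "x \<in> L1" "y \<in> L2" for x y
    using set_plus_intro[OF that] by blast
  with L(1) show ?thesis by (rule that)
qed

lemma U_add:
  assumes "x \<in> U j" "y \<in> U k"
  shows "x + y \<in> U (j + k)"
proof -
  obtain L1 L2 where L: "L1 \<in> \<L>" "j \<in> L1" "x \<in> L1" "L2 \<in> \<L>" "k \<in> L2" "y \<in> L2"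
    using assms unfolding mem_U_iff by blast
  obtain L where "L \<in> \<L>" "\<And>x y. x \<in> L1 \<Longrightarrow> y \<in> L2 \<Longrightarrow> x + y \<in> L"
    using directed_sum[OF L(1,4)] by blast
  with L show ?thesis unfolding mem_U_iff by blast
qed

text \<open>Repeated sums of the member containing 1 give every positive \<open>k\<close>; no member
  need contain 0.\<close>

lemma U_self:
  assumes "1 \<le> k"
  shows "k \<in> U k"
  using assms
proof (induction k rule: dec_induct)
  case base
  show ?case using directed unfolding directed_family_def mem_U_iff by blast
next
  case (step n)
  then have "1 \<in> U 1" using directed unfolding directed_family_def mem_U_iff by blast
  with step U_add[of n n 1 1] show ?case by simp
qed

lemma distances_ge:
  assumes "L \<in> \<L>" "d \<in> distances L"
  shows "\<delta> \<le> d"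
  using assms finite_distances unfolding delta_def fam_distances_def by (intro Min_le) auto

lemma distances_le:
  assumes "L \<in> \<L>" "d \<in> distances L"
  shows "d \<le> Max (fam_distances \<L>)"
  using assms finite_distances unfolding fam_distances_def by (intro Max_ge) auto

lemma diff_ge_delta:
  assumes "L \<in> \<L>" "x \<in> L" "y \<in> L" "x < y"
  shows "x + \<delta> \<le> y"
  using distance_after[OF assms(2-4)] distances_ge[OF assms(1)] by fastforce

lemma distances_obtain:
  assumes "d \<in> fam_distances \<L>"
  obtains L x where "L \<in> \<L>" "0 < d" "x \<in> L" "x + d \<in> L"
proof -
  obtain L x y where L: "L \<in> \<L>" "0 < d" "x \<in> L" "y \<in> L" "int y - int x = int d"
    using assms unfolding fam_distances_def distances_def by blast
  then have "y = x + d" by linarith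
  with L that show ?thesis by blast
qed

lemma delta_in: "\<delta> \<in> fam_distances \<L>"
  using Min_in[OF finite_distances distances_nonempty] unfolding delta_def .

lemma delta_pos: "0 < \<delta>"
  using distances_obtain[OF delta_in] by blast

section \<open>Progressions inside members\<close>

lemma ladder_oneI:
  assumes "L \<in> \<L>" "x \<in> L" "x + \<delta> \<in> L"
  shows "ladder x 1"
  unfolding ladder_def
proof (intro bexI[OF _ assms(1)] allI impI)
  fix i :: nat assume "i \<le> 1"
  then have "i = 0 \<or> i = 1" by linarith
  with assms show "x + i * \<delta> \<in> L" by (elim disjE) simp_all
qed

lemma ladder_one: "\<exists>l. ladder l 1"
proof -
  obtain L x where "L \<in> \<L>" "x \<in> L" "x + \<delta> \<in> L"
    using distances_obtain[OF delta_in] by blast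
  then show ?thesis using ladder_oneI by blast
qed

lemma ladder_add:
  assumes "ladder a s" "ladder b t"
  shows "ladder (a + b) (s + t)"
proof -
  obtain L1 L2 where L: "L1 \<in> \<L>" "L2 \<in> \<L>"
      "\<And>i. i \<le> s \<Longrightarrow> a + i * \<delta> \<in> L1" "\<And>i. i \<le> t \<Longrightarrow> b + i * \<delta> \<in> L2"
    using assms unfolding ladder_def by blast
  obtain L where L': "L \<in> \<L>" "\<And>x y. x \<in> L1 \<Longrightarrow> y \<in> L2 \<Longrightarrow> x + y \<in> L"
    using directed_sum[OF L(1,2)] by blast
  have "a + b + i * \<delta> \<in> L" if "i \<le> s + t" for i
  proof -
    \<comment> \<open>The first progression takes as many steps as it has, the second takes the
      rest.\<close>
    have "\<exists>i1 i2. i = i1 + i2 \<and> i1 \<le> s \<and> i2 \<le> t"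
      using that by (intro exI[of _ "min i s"] exI[of _ "i - min i s"]) auto
    then obtain i1 i2 where i: "i = i1 + i2" "i1 \<le> s" "i2 \<le> t" by blast
    then have "(a + i1 * \<delta>) + (b + i2 * \<delta>) \<in> L" by (intro L' L)
    with i show ?thesis by (simp add: algebra_simps)
  qed
  with L' show ?thesis unfolding ladder_def by blast
qed

lemma ladder_mult:
  assumes "ladder a s" "1 \<le> n"
  shows "ladder (n * a) (n * s)"
  using assms(2)
proof (induction n rule: dec_induct)
  case base
  show ?case using assms by simp
next
  case (step n)
  then show ?case using ladder_add[OF assms(1) step.IH] by simp
qed

lemma ladder_U:
  assumes "ladder a s" "i \<le> s" "j \<le> s"
  shows "a + i * \<delta> \<in> U (a + j * \<delta>)"
  using assms unfolding ladder_def mem_U_iff by blast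

text \<open>If \<open>y - x = t \<delta> + r\<close> with \<open>0 < r < \<delta>\<close>, then adding \<open>t\<close> copies of a set
  containing \<open>l\<close> and \<open>l + \<delta>\<close> produces two elements at distance \<open>r\<close>.\<close>

lemma mem_cong:
  assumes L: "L \<in> \<L>" "x \<in> L" "y \<in> L"
  shows "x mod \<delta> = y mod \<delta>"
proof -
  have dvd: "\<delta> dvd v - u" if uv: "u \<in> L" "v \<in> L" "u < v" for u v
  proof (rule ccontr)
    assume ndvd: "\<not> \<delta> dvd v - u"
    define t r where "t = (v - u) div \<delta>" and "r = (v - u) mod \<delta>"
    have r: "0 < r" "r < \<delta>"
      using ndvd delta_pos unfolding r_def by (simp_all add: mod_greater_zero_iff_not_dvd)
    have "v - u = t * \<delta> + r" unfolding t_def r_def by (rule div_mult_mod_eq[symmetric])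
    then have vu: "v = u + t * \<delta> + r" using uv(3) by linarith
    have "u + \<delta> \<le> v" using diff_ge_delta[OF L(1) uv] .
    then have "1 \<le> t" using vu r by (cases t) auto
    obtain l where "ladder l 1" using ladder_one by blast
    then have "ladder (t * l) t" using ladder_mult[of l 1 t] \<open>1 \<le> t\<close> by simp
    then obtain L1 where L1: "L1 \<in> \<L>" "\<And>i. i \<le> t \<Longrightarrow> t * l + i * \<delta> \<in> L1"
      unfolding ladder_def by blast
    obtain L' where L': "L' \<in> \<L>" "\<And>x y. x \<in> L \<Longrightarrow> y \<in> L1 \<Longrightarrow> x + y \<in> L'"
      using directed_sum[OF L(1) L1(1)] by blast
    have "t * l + t * \<delta> \<in> L1" "t * l \<in> L1" using L1(2)[of t] L1(2)[of 0] by simp_all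
    then have "u + (t * l + t * \<delta>) \<in> L'" "v + t * l \<in> L'"
      using uv L'(2) by blast+
    from diff_ge_delta[OF L'(1) this] show False using vu r by linarith
  qed
  show ?thesis
  proof (cases x y rule: linorder_cases)
    case less
    show ?thesis
      by (rule iffD2[OF mod_eq_iff_dvd_diff[OF less_imp_le[OF less]] dvd[OF L(2,3) less]])
  next
    case greater
    show ?thesis
      by (rule iffD2[OF mod_eq_iff_dvd_diff[OF less_imp_le[OF greater]] dvd[OF L(3,2) greater], symmetric])
  next
    case equal
    then show ?thesis by (rule arg_cong)
  qed
qed

lemma U_cong: "x \<in> U k \<Longrightarrow> x mod \<delta> = k mod \<delta>"
  unfolding mem_U_iff using mem_cong by blast

lemma cong_less_imp:
  assumes "x mod \<delta> = y mod \<delta>" "x < y"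
  shows "x + \<delta> \<le> y"
proof -
  have "\<delta> dvd y - x" using assms mod_eq_iff_dvd_diff[of x y \<delta>] by simp
  then have "\<delta> \<le> y - x" using assms by (intro dvd_imp_le) auto
  with assms show ?thesis by linarith
qed

lemma U_less_imp:
  assumes "x \<in> U k" "y \<in> U k" "x < y"
  shows "x + \<delta> \<le> y"
  by (rule cong_less_imp[OF _ assms(3)]) (simp only: U_cong[OF assms(1)] U_cong[OF assms(2)])

section \<open>Gaps of the unions\<close>

definition q :: nat where
  "q = Max (fam_distances \<L>) div \<delta>"

text \<open>The maximal distance is a difference of two elements of one member, and these are
  congruent modulo \<open>\<delta>\<close>.\<close>

lemma delta_dvd_Max: "\<delta> dvd Max (fam_distances \<L>)"
proof -
  obtain L x where "L \<in> \<L>" "x \<in> L" "x + Max (fam_distances \<L>) \<in> L"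
    using distances_obtain[OF Max_in[OF finite_distances distances_nonempty]] by blast
  then show ?thesis
    using mem_cong[of L x "x + Max (fam_distances \<L>)"] mod_eq_iff_dvd_diff[of x "x + Max (fam_distances \<L>)" \<delta>]
    by (metis add_diff_cancel_left' le_add1)
qed

lemma q_delta: "q * \<delta> = Max (fam_distances \<L>)"
  using delta_dvd_Max unfolding q_def by simp

lemma q_pos: "1 \<le> q"
proof -
  have "0 < Max (fam_distances \<L>)"
    using distances_obtain[OF Max_in[OF finite_distances distances_nonempty]] by blast
  then show ?thesis using q_delta by (cases q) auto
qed

lemma gaps_le_mem:
  assumes "L \<in> \<L>"
  shows "gaps_le (q * \<delta>) L"
  unfolding gaps_le_def
proof (intro ballI impI)
  fix w v assume "w \<in> L" "v \<in> L" "w < v"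
  then obtain w' where w': "w' \<in> L" "w < w'" "w' - w \<in> distances L"
    using distance_after by blast
  with distances_le[OF assms] q_delta have "w' - w \<le> q * \<delta>" by simp
  with w' show "\<exists>w'\<in>L. w < w' \<and> w' \<le> w + q * \<delta>" by (intro bexI[of _ w']) auto
qed

text \<open>All members in question share \<open>k\<close>, so one of them has elements on both
  sides of the gap. For \<open>k \<le> w\<close> it is a member containing \<open>v\<close>, left
  from its last element up to \<open>w\<close>; for \<open>w < k\<close> it is a member containing
  \<open>w\<close>.\<close>

lemma gaps_le_U: "gaps_le (q * \<delta>) (U k)"
  unfolding gaps_le_def
proof (intro ballI impI)
  fix w v assume wv: "w \<in> U k" "v \<in> U k" "w < v"
  show "\<exists>w'\<in>U k. w < w' \<and> w' \<le> w + q * \<delta>"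
  proof (cases "k \<le> w")
    case True
    obtain L where L: "L \<in> \<L>" "k \<in> L" "v \<in> L" using wv unfolding mem_U_iff by blast
    define u where "u = Max (L \<inter> {..w})"
    have fin: "finite (L \<inter> {..w})" by simp
    have "u \<in> L \<inter> {..w}" unfolding u_def using L True by (intro Max_in) auto
    then have u: "u \<in> L" "u \<le> w" by auto
    then have "u < v" using wv by simp
    then obtain w' where w': "w' \<in> L" "u < w'" "w' \<le> u + q * \<delta>"
      using gaps_le_mem[OF L(1)] L(3) u(1) unfolding gaps_le_def by blast
    have "w < w'" using w' Max_ge[OF fin, of w'] unfolding u_def[symmetric] by (cases "w' \<le> w") auto
    moreover have "w' \<le> w + q * \<delta>" using w' u by linarith
    moreover have "w' \<in> U k" using w'(1) L(1,2) unfolding mem_U_iff by blast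
    ultimately show ?thesis by blast
  next
    case False
    obtain L where L: "L \<in> \<L>" "k \<in> L" "w \<in> L" using wv unfolding mem_U_iff by blast
    have "w < k" using False by simp
    then obtain w' where w': "w' \<in> L" "w < w'" "w' \<le> w + q * \<delta>"
      using gaps_le_mem[OF L(1)] L(2,3) unfolding gaps_le_def by blast
    moreover have "w' \<in> U k" using w'(1) L(1,2) unfolding mem_U_iff by blast
    ultimately show ?thesis by blast
  qed
qed

text \<open>The gaps of \<open>U k\<close> are at most \<open>q \<delta>\<close>, so adding a progression of at least \<open>q\<close> steps closes them.\<close>

lemma U_full:
  assumes lad: "ladder a s" "j \<le> s" "q \<le> s"
    and z: "z mod \<delta> = (k + a) mod \<delta>"
    and uv: "u \<in> U k" "v \<in> U k" "a + u \<le> z" "z \<le> a + s * \<delta> + v"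
  shows "z \<in> U (k + (a + j * \<delta>))"
proof -
  have "gaps_le (s * \<delta>) (U k)"
    using gaps_le_mono[OF gaps_le_U] lad by simp
  moreover have "u \<le> z - a" "z - a \<le> v + s * \<delta>" using uv by linarith+
  ultimately obtain w where w: "w \<in> U k" "w \<le> z - a" "z - a \<le> w + s * \<delta>"
    using gaps_le_cover uv(1,2) by blast
  then have wz: "w + a \<le> z" using uv by linarith
  have "(w + a) mod \<delta> = z mod \<delta>" using z U_cong[OF w(1)] by (metis mod_add_cong)
  then have "\<delta> dvd z - (w + a)" using wz mod_eq_iff_dvd_diff[of "w + a" z \<delta>] by simp
  then obtain i where i: "z - (w + a) = i * \<delta>" by (metis dvd_def mult.commute)
  then have "i * \<delta> \<le> s * \<delta>" using w wz by linarith
  then have "i \<le> s" using delta_pos by simp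
  moreover have "z = w + (a + i * \<delta>)" using i wz by linarith
  \<comment> \<open>Step \<open>j\<close> of the progression goes into the index and step
    \<open>i\<close> into the element; both lie in one member, so they are chosen
    independently.\<close>
  ultimately show ?thesis using U_add[OF w(1) ladder_U[OF lad(1) _ lad(2)]] by simp
qed

text \<open>Take \<open>i\<close> copies of the one-step progression and add the remainder
  \<open>k - i * l\<close> to index and element; the strict bound keeps this remainder
  positive.\<close>

lemma U_climb:
  assumes "ladder l 1" "i * l < k"
  shows "k + i * \<delta> \<in> U k"
proof (cases "i = 0")
  case True
  then show ?thesis using U_self assms by simp
next
  case False
  then have "ladder (i * l) i" using ladder_mult[OF assms(1), of i] by simp
  from U_add[OF U_self[of "k - i * l"] ladder_U[OF this, of i 0]] assms
  show ?thesis by simp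
qed

text \<open>Controls the lower end with a bound independent of \<open>h\<close>. By symmetry one
  searches \<open>U u\<close>, which contains \<open>u\<close> and \<open>k\<close>, for
  \<open>w\<close> just below \<open>k - h\<close>, and then adds \<open>k - h - w\<close> on both
  sides. If \<open>u\<close> exceeds \<open>k - h\<close>, then \<open>k - h\<close> itself
  serves.\<close>

lemma U_inf_shift:
  assumes "h < k" "u \<in> U k"
  shows "\<exists>u'\<in>U (k - h). u' \<le> u + q * \<delta>"
proof (cases "u \<le> k - h")
  case True
  have "k \<in> U u" "u \<in> U u" using assms unfolding mem_U_iff by blast+
  moreover have "k - h \<le> k + q * \<delta>" by simp
  ultimately obtain w where w: "w \<in> U u" "w \<le> k - h" "k - h \<le> w + q * \<delta>"
    using gaps_le_cover[OF gaps_le_U _ _ True] by blast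
  have "u \<in> U w" using w U_sym by blast
  show ?thesis
  proof (cases "w = k - h")
    case True
    with \<open>u \<in> U w\<close> have "u \<in> U (k - h)" by simp
    then show ?thesis by (intro bexI[of _ u]) simp_all
  next
    case False
    then have "u + (k - h - w) \<in> U (k - h)"
      using U_add[OF \<open>u \<in> U w\<close> U_self[of "k - h - w"]] w by simp
    with w show ?thesis by (intro bexI) auto
  qed
next
  case False
  with assms show ?thesis by (intro bexI[OF _ U_self]) auto
qed

text \<open>If \<open>U k'\<close> is unbounded, both sides are empty.\<close>

lemma fam_interval_eq:
  assumes "U k \<noteq> {}" "U k' \<noteq> {}"
  shows "U k \<inter> int -` int_ivl (ereal_of_enat (fam_rho_at \<L> k') + ereal (real h))
                              (ereal_of_enat (fam_rho_at \<L> k) - ereal (real M))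
    = {x\<in>U k. (\<forall>v\<in>U k'. v + h \<le> x) \<and> (\<exists>v\<in>U k. x + M \<le> v)}"
  unfolding fam_rho_at_def
  by (auto simp: int_mem_int_ivl_iff sup_set_add_le_iff[OF assms(2)] le_sup_set_iff[OF assms(1)])

section \<open>The Structure Theorem for Unions\<close>

lemma structure_theorem_imp:
  assumes lad: "ladder l 1"
    and st: "structure_theorem_for_unions \<L>"
  shows "\<exists>M. \<forall>\<^sub>F k in sequentially.
    let I = {x\<in>U k. (\<forall>v\<in>U (k - l * q). v + l * q \<le> x) \<and> (\<exists>v\<in>U k. x + M \<le> v)}
    in I = {} \<or> is_AP \<delta> I"
proof -
  obtain d M K where K: "0 < d" "\<And>k. K \<le> k \<Longrightarrow> is_AAP d M (U k)"
    using st unfolding structure_theorem_for_unions_def eventually_sequentially by blast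
  have AP: "is_AP d {x\<in>U k. (\<exists>u\<in>U k. u + M \<le> x) \<and> (\<exists>v\<in>U k. x + M \<le> v)}"
    if "K \<le> k" "1 \<le> k" for k
    using K(2)[OF that(1)] is_AAP_iff[of "U k" d M] U_self[OF that(2)] by blast
  have M_le: "M \<le> M * \<delta>" using delta_pos by simp
  \<comment> \<open>For large \<open>k\<close> the union contains \<open>2 * M + 2\<close>
    consecutive terms from \<open>k\<close> on. The two middle ones survive trimming by
    \<open>M\<close>, so \<open>d\<close> is at most \<open>\<delta>\<close>; smaller differences do
    not occur in \<open>U k\<close>.\<close>
  have "d = \<delta>"
  proof -
    define k where "k = K + (2 * M + 1) * l + 1"
    let ?S = "{x\<in>U k. (\<exists>u\<in>U k. u + M \<le> x) \<and> (\<exists>v\<in>U k. x + M \<le> v)}"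
    have climb: "k + i * \<delta> \<in> U k" if "i \<le> 2 * M + 1" for i
      using that mult_le_mono1[OF that, of l] by (intro U_climb[OF lad]) (simp add: k_def)
    have mid: "k + i * \<delta> \<in> ?S" if "M \<le> i" "i \<le> M + 1" for i
    proof -
      have "M * \<delta> \<le> i * \<delta>" using that by simp
      then have "k + M \<le> k + i * \<delta>" using M_le by linarith
      moreover have "(i + M) * \<delta> \<le> (2 * M + 1) * \<delta>" using that by (intro mult_le_mono1) simp
      then have "k + i * \<delta> + M \<le> k + (2 * M + 1) * \<delta>"
        using M_le by (simp only: add_mult_distrib)
      moreover have "k \<in> U k" "k + (2 * M + 1) * \<delta> \<in> U k" "k + i * \<delta> \<in> U k"
        using climb[of 0] climb[of "2 * M + 1"] climb[of i] that by simp_all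
      ultimately show ?thesis by blast
    qed
    have "k + M * \<delta> < k + (M + 1) * \<delta>" using delta_pos by simp
    moreover have "is_AP d ?S" using AP[of k] unfolding k_def by simp
    moreover have "k + M * \<delta> \<in> ?S" "k + (M + 1) * \<delta> \<in> ?S" by (rule mid; simp)+
    ultimately have "k + M * \<delta> + d \<in> ?S" "k + M * \<delta> + d \<le> k + (M + 1) * \<delta>"
      unfolding is_AP_iff by blast+
    then have "k + M * \<delta> + d \<in> U k" "k + M * \<delta> + d \<le> k + (M + 1) * \<delta>" by blast+
    moreover from this(1) have "k + M * \<delta> + \<delta> \<le> k + M * \<delta> + d"
      using K(1) climb[of M] by (intro U_less_imp[of _ k]) auto
    ultimately show ?thesis by simp
  qed
  have "I = {} \<or> is_AP \<delta> I"
    if k: "K + l * q + M * l + 1 \<le> k"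
      and I: "I = {x\<in>U k. (\<forall>v\<in>U (k - l * q). v + l * q \<le> x) \<and> (\<exists>v\<in>U k. x + M \<le> v)}" for k I
  proof -
    let ?S = "{x\<in>U k. (\<exists>u\<in>U k. u + M \<le> x) \<and> (\<exists>v\<in>U k. x + M \<le> v)}"
    \<comment> \<open>This element pushes \<open>I\<close> above \<open>k + M\<close>, so the lower
      trimming of the almost arithmetical progression does not touch \<open>I\<close>.\<close>
    have v: "k - l * q + M * \<delta> \<in> U (k - l * q)" using k by (intro U_climb[OF lad]) linarith
    have "k \<in> U k" using k by (intro U_self) simp
    have sub: "x \<in> ?S" if "x \<in> I" for x
    proof -
      have "k - l * q + M * \<delta> + l * q \<le> x" using that v unfolding I by blast
      then have "k + M \<le> x" using k M_le by linarith
      with that \<open>k \<in> U k\<close> show ?thesis unfolding I by blast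
    qed
    have "x + \<delta> \<in> I \<and> x + \<delta> \<le> y" if xy: "x \<in> I" "y \<in> I" "x < y" for x y
    proof -
      have "is_AP \<delta> ?S" using AP[of k] k unfolding \<open>d = \<delta>\<close> by linarith
      note step = is_AP_step[OF this sub[OF xy(1)] sub[OF xy(2)] xy(3)]
      have "v + l * q \<le> x + \<delta>" if "v \<in> U (k - l * q)" for v
        using xy(1) that unfolding I by (simp add: trans_le_add1)
      with step show ?thesis unfolding I by simp
    qed
    then show ?thesis unfolding is_AP_iff using delta_pos by blast
  qed
  then show ?thesis unfolding Let_def eventually_sequentially by blast
qed

lemma imp_structure_theorem:
  assumes lad: "ladder l 1"
    and ev: "\<forall>\<^sub>F k in sequentially.
      let I = {x\<in>U k. (\<forall>v\<in>U (k - l * q). v + l * q \<le> x) \<and> (\<exists>v\<in>U k. x + M \<le> v)}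
      in I = {} \<or> is_AP \<delta> I"
  shows "structure_theorem_for_unions \<L>"
proof -
  define I where
    "I k = {x\<in>U k. (\<forall>v\<in>U (k - l * q). v + l * q \<le> x) \<and> (\<exists>v\<in>U k. x + M \<le> v)}" for k
  obtain K where "\<And>k. K \<le> k \<Longrightarrow> I k = {} \<or> is_AP \<delta> (I k)"
    using ev unfolding eventually_sequentially Let_def I_def[symmetric] by blast
  then have K: "x + \<delta> \<in> I k" if "K \<le> k" "x \<in> I k" "y \<in> I k" "x < y" for k x y
    using that unfolding is_AP_iff by blast
  \<comment> \<open>The summand \<open>q * \<delta>\<close> pays for \<open>U_inf_shift\<close>,
    \<open>l * q\<close> for the first term of the added progression, and \<open>M\<close> for the
    assumption at the upper end.\<close>
  define N where "N = M + q * \<delta> + l * q"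
  have N_le: "N \<le> N * \<delta>" using delta_pos by simp
  have "is_AAP \<delta> N (U k)" if k: "K + l * q + 2 * N * l + 1 \<le> k" for k
  proof -
    let ?S = "{x\<in>U k. (\<exists>u\<in>U k. u + N \<le> x) \<and> (\<exists>v\<in>U k. x + N \<le> v)}"
    have self: "k \<in> U k" using k by (intro U_self) simp
    \<comment> \<open>The middle term \<open>k + N * \<delta>\<close> survives trimming because of
      its neighbours \<open>k\<close> and \<open>k + (2 * N) * \<delta>\<close>.\<close>
    have "k + N * \<delta> \<in> U k" "k + (2 * N) * \<delta> \<in> U k"
      using k by (intro U_climb[OF lad]; linarith)+
    moreover have "k + N \<le> k + N * \<delta>" "k + N * \<delta> + N \<le> k + (2 * N) * \<delta>"
      using N_le by auto
    ultimately have ne: "?S \<noteq> {}" using self by blast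
    have "x + \<delta> \<in> ?S \<and> x + \<delta> \<le> y" if xy: "x \<in> ?S" "y \<in> ?S" "x < y" for x y
    proof -
      obtain u v where u: "x \<in> U k" "u \<in> U k" "u + N \<le> x" and v: "y \<in> U k" "v \<in> U k" "y + N \<le> v"
        using xy by blast
      have le: "x + \<delta> \<le> y" using U_less_imp[OF u(1) v(1) xy(3)] .
      obtain u' where u': "u' \<in> U (k - l * q)" "u' \<le> u + q * \<delta>"
        using U_inf_shift[OF _ u(2), of "l * q"] k by auto
      have "x + \<delta> \<in> U k"
      \<comment> \<open>Either \<open>x + \<delta>\<close> is within reach of the filling by
        \<open>q\<close> steps, or, as \<open>\<delta> \<le> q * \<delta>\<close>, both
        \<open>x\<close> and \<open>y\<close> lie in the range \<open>I k\<close> governed by the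
        assumption.\<close>
      proof (cases "\<exists>v'\<in>U (k - l * q). x + \<delta> \<le> q * l + q * \<delta> + v'")
        case True
        then obtain v' where v': "v' \<in> U (k - l * q)" "x + \<delta> \<le> q * l + q * \<delta> + v'" by blast
        have "ladder (q * l) q" using ladder_mult[OF lad q_pos] by simp
        moreover have "(x + \<delta>) mod \<delta> = (k - l * q + q * l) mod \<delta>"
          using U_cong[OF u(1)] k by (simp add: mult.commute)
        moreover have "q * l + u' \<le> x + \<delta>" using u u' unfolding N_def by (simp add: mult.commute)
        ultimately have "x + \<delta> \<in> U (k - l * q + (q * l + 0 * \<delta>))"
          using u' v' by (intro U_full) auto
        then show ?thesis using k by (simp add: mult.commute)
      next
        case False
        have "\<delta> \<le> q * \<delta>" using q_pos by simp
        with False have lo: "v' + l * q \<le> x" if "v' \<in> U (k - l * q)" for v'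
        proof -
          have "\<not> x + \<delta> \<le> q * l + q * \<delta> + v'" using False that by blast
          then show ?thesis using \<open>\<delta> \<le> q * \<delta>\<close> mult.commute[of l q] by linarith
        qed
        have M: "x + M \<le> v" "y + M \<le> v" using v(3) xy(3) unfolding N_def by linarith+
        have lo': "v' + l * q \<le> y" if "v' \<in> U (k - l * q)" for v'
          using lo[OF that] xy(3) by linarith
        have "x \<in> I k" "y \<in> I k"
          unfolding I_def mem_Collect_eq
          by (intro conjI ballI bexI[OF _ v(2)] u(1) v(1) lo lo' M; assumption)+
        then have "x + \<delta> \<in> I k" using K[of k x y] k xy(3) by simp
        then show ?thesis unfolding I_def by blast
      qed
      moreover have "u + N \<le> x + \<delta>" "x + \<delta> + N \<le> v" using u v le by linarith+
      ultimately show ?thesis using le u(2) v(2) by blast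
    qed
    then have "is_AP \<delta> ?S" unfolding is_AP_iff using ne delta_pos by blast
    moreover have "\<exists>z. int x = int k + int \<delta> * z" if "x \<in> U k" for x
    proof -
      have "int x mod int \<delta> = int k mod int \<delta>" using U_cong[OF that] by (metis of_nat_mod)
      then have "int \<delta> dvd int x - int k" by (simp add: mod_eq_dvd_iff)
      then obtain z where "int x - int k = int \<delta> * z" by (rule dvdE)
      then show ?thesis by (intro exI[of _ z]) simp
    qed
    then have "int ` U k \<subseteq> {int k + int \<delta> * z |z. True}" by auto
    ultimately show ?thesis using is_AAP_iff[of "U k" \<delta> N] self delta_pos by blast
  qed
  then show ?thesis
    unfolding structure_theorem_for_unions_def eventually_sequentially using delta_pos by blast
qed

section \<open>Families with finite accepted elasticity\<close>

text \<open>Elasticity ignores 0, so 0 has to be excluded separately: together with some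
  \<open>y > 0\<close> it would produce members with arbitrarily large ratios.\<close>

lemma extremal_bounds:
  assumes "1 \<le> a" and bound: "\<And>L x y. L \<in> \<L> \<Longrightarrow> x \<in> L \<Longrightarrow> y \<in> L \<Longrightarrow> 0 < x \<Longrightarrow> y * a \<le> b * x"
  shows "L \<in> \<L> \<Longrightarrow> x \<in> L \<Longrightarrow> y \<in> L \<Longrightarrow> 0 < y \<Longrightarrow> 0 < x" and "a < b"
proof -
  \<comment> \<open>Adding \<open>L\<close> repeatedly creates multiples of \<open>y\<close>, while
    its element 0 keeps \<open>y\<close> itself as a positive denominator.\<close>
  have mult: "\<exists>L'\<in>\<L>. 0 \<in> L' \<and> y \<in> L' \<and> Suc n * y \<in> L'"
    if L: "L \<in> \<L>" "0 \<in> L" "y \<in> L" for L y n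
  proof (induction n)
    case 0
    show ?case using L by auto
  next
    case (Suc n)
    then obtain L' where L': "L' \<in> \<L>" "0 \<in> L'" "y \<in> L'" "Suc n * y \<in> L'" by blast
    obtain L'' where "L'' \<in> \<L>" "\<And>s t. s \<in> L \<Longrightarrow> t \<in> L' \<Longrightarrow> s + t \<in> L''"
      using directed_sum[OF L(1) L'(1)] by blast
    then have "L'' \<in> \<L>" "0 + 0 \<in> L''" "y + 0 \<in> L''" "y + Suc n * y \<in> L''" using L L' by blast+
    then show ?case by auto
  qed
  show pos: "0 < x" if "L \<in> \<L>" "x \<in> L" "y \<in> L" "0 < y" for L x y
  proof (rule ccontr)
    assume "\<not> 0 < x"
    then have "0 \<in> L" using \<open>x \<in> L\<close> by simp
    then obtain L' where "L' \<in> \<L>" "y \<in> L'" "Suc b * y \<in> L'"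
      using mult[OF \<open>L \<in> \<L>\<close> _ \<open>y \<in> L\<close>] by blast
    from bound[OF this \<open>0 < y\<close>] have "Suc b * a * y \<le> b * y" by (simp add: algebra_simps)
    then have "Suc b * a \<le> b" using \<open>0 < y\<close> mult_le_cancel2 by blast
    moreover have "Suc b \<le> Suc b * a"
      using mult_le_mono2[OF assms(1), of "Suc b"] by (simp only: mult_1_right)
    ultimately have "Suc b \<le> b" by (rule order_trans[rotated])
    then show False by simp
  qed
  \<comment> \<open>Two distinct positive elements of one member have a ratio above 1, which
    \<open>b / a\<close> bounds.\<close>
  obtain L x where L: "L \<in> \<L>" "x \<in> L" "x + \<delta> \<in> L"
    using distances_obtain[OF delta_in] by blast
  then have "0 < x" using pos[of L x "x + \<delta>"] delta_pos by simp
  have "a * x < (x + \<delta>) * a" using assms(1) delta_pos by (simp add: algebra_simps)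
  also have "\<dots> \<le> b * x" using bound[OF L \<open>0 < x\<close>] .
  finally show "a < b" by simp
qed

text \<open>The extremal quotient is attained by two elements of \<open>Ls\<close>, and
  \<open>Ls\<close> contains the whole progression between them.\<close>

lemma extremal_ladder:
  assumes fin: "fam_elasticity \<L> < \<infinity>"
    and Ls: "Ls \<in> \<L>" "elasticity Ls = fam_elasticity \<L>" "is_AP \<delta> Ls"
  obtains a s where "1 \<le> a" "q \<le> s" "ladder a s"
    "\<And>L x y. L \<in> \<L> \<Longrightarrow> x \<in> L \<Longrightarrow> y \<in> L \<Longrightarrow> 0 < x \<Longrightarrow> y * a \<le> (a + s * \<delta>) * x"
proof -
  have le: "of_nat y / of_nat x \<le> elasticity Ls" if "L \<in> \<L>" "x \<in> L" "y \<in> L" "0 < x" for L x y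
    using elasticity_ge[OF that(2-4)] SUP_upper[OF that(1), of elasticity] Ls(2)
    unfolding fam_elasticity_def by simp
  have pos_part: "pos_part Ls \<noteq> {}"
  \<comment> \<open>Otherwise the default elasticity 1 would bound all ratios, which
    \<open>extremal_bounds\<close> refutes with \<open>a = b = 1\<close>.\<close>
  proof
    assume "pos_part Ls = {}"
    then have "elasticity Ls = of_nat 1 / of_nat 1" unfolding elasticity_def by simp
    then have "y * 1 \<le> 1 * x" if "L \<in> \<L>" "x \<in> L" "y \<in> L" "0 < x" for L x y
      using le[OF that] ennreal_of_nat_divide_le_iff[of x 1 y 1] that by simp
    from extremal_bounds(2)[OF _ this] show False by simp
  qed
  obtain a b where ab: "a \<in> Ls" "b \<in> Ls" "0 < a" "elasticity Ls = of_nat b / of_nat a"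
    using elasticity_finite_obtain[OF _ pos_part] fin Ls(2) by metis
  have bound: "y * a \<le> b * x" if "L \<in> \<L>" "x \<in> L" "y \<in> L" "0 < x" for L x y
    using le[OF that] ennreal_of_nat_divide_le_iff[of x a y b] that ab by simp
  have "a < b" using extremal_bounds(2)[OF _ bound] ab(3) by simp
  have "a mod \<delta> = b mod \<delta>" using mem_cong[OF Ls(1) ab(1,2)] .
  then have "\<delta> dvd b - a" using \<open>a < b\<close> mod_eq_iff_dvd_diff[of a b \<delta>] by simp
  then obtain s where s: "b = a + s * \<delta>"
    using \<open>a < b\<close> by (metis dvd_def le_add_diff_inverse less_imp_le mult.commute)
  then have "1 \<le> s" using \<open>a < b\<close> by (cases s) auto
  have "a + i * \<delta> \<in> Ls" if "i \<le> s" for i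
    using that
  proof (induction i)
    case 0
    show ?case using ab by simp
  next
    case (Suc i)
    then have "a + i * \<delta> < b" unfolding s using delta_pos by simp
    with Suc ab Ls(3) have "a + i * \<delta> + \<delta> \<in> Ls" unfolding is_AP_iff by auto
    then show ?case by (simp add: algebra_simps)
  qed
  then have "ladder a s" using Ls(1) unfolding ladder_def by blast
  show ?thesis
  \<comment> \<open>Scaling by \<open>q\<close> preserves the ratio and yields the \<open>q\<close>
    steps that \<open>U_full\<close> requires.\<close>
  proof (rule that[of "q * a" "q * s"])
    show "1 \<le> q * a" "q \<le> q * s" using q_pos ab(3) \<open>1 \<le> s\<close> by auto
    show "ladder (q * a) (q * s)" using ladder_mult[OF \<open>ladder a s\<close> q_pos] .
    fix L x y assume "L \<in> \<L>" "x \<in> L" "y \<in> L" "0 < x"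
    from mult_le_mono2[OF bound[OF this], of q]
    show "y * (q * a) \<le> (q * a + q * s * \<delta>) * x" unfolding s by (simp add: algebra_simps)
  qed
qed

lemma accepted_elasticity_imp_AP:
  assumes "fam_elasticity \<L> < \<infinity>"
    and "Ls \<in> \<L>" "elasticity Ls = fam_elasticity \<L>" "is_AP \<delta> Ls"
  shows "\<forall>\<^sub>F k in sequentially. is_AP \<delta> (U k)"
proof -
  obtain a s where as: "1 \<le> a" "q \<le> s" "ladder a s"
    and bound: "\<And>L x y. L \<in> \<L> \<Longrightarrow> x \<in> L \<Longrightarrow> y \<in> L \<Longrightarrow> 0 < x \<Longrightarrow> y * a \<le> (a + s * \<delta>) * x"
    using extremal_ladder[OF assms] by metis
  define b where "b = a + s * \<delta>"
  have upper: "x * a \<le> b * k" if "x \<in> U k" "1 \<le> k" for x k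
    using that bound unfolding mem_U_iff b_def by auto
  have lower: "k * a \<le> b * x" if xk: "x \<in> U k" "1 \<le> k" for x k
  proof -
    obtain L where L: "L \<in> \<L>" "k \<in> L" "x \<in> L" using xk unfolding mem_U_iff by blast
    then have "0 < x" using extremal_bounds(1)[OF as(1) bound L(1,3,2)] xk by simp
    then show ?thesis using bound L unfolding b_def by blast
  qed
  have finU: "finite (U k)" if "1 \<le> k" for k
  proof -
    have "x \<le> b * k" if "x \<in> U k" for x
      using upper[OF that \<open>1 \<le> k\<close>] as(1) mult_le_mono2[of 1 a x] by linarith
    then show ?thesis using finite_nat_set_iff_bounded_le by blast
  qed
  define R where "R k = Max (U k)" for k
  define r where "r k = Min (U k)" for k
  have R: "R k \<in> U k" "x \<in> U k \<Longrightarrow> x \<le> R k" if "1 \<le> k" for k x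
    unfolding R_def using finU[OF that] U_self[OF that] by (auto intro: Max_in)
  have r: "r k \<in> U k" "x \<in> U k \<Longrightarrow> r k \<le> x" if "1 \<le> k" for k x
    unfolding r_def using finU[OF that] U_self[OF that] by (auto intro: Min_in)
  have ab: "b \<in> U a" "a \<in> U b"
    using ladder_U[OF as(3), of s 0] ladder_U[OF as(3), of 0 s] unfolding b_def by auto
  have Rstep: "R k + b \<le> R (k + a)" if "1 \<le> k" for k
    using U_add[OF R(1)[OF that] ab(1)] R(2)[of "k + a"] that by simp
  have rstep: "r (k + b) \<le> r k + a" if "1 \<le> k" for k
    using U_add[OF r(1)[OF that] ab(2)] r(2)[of "k + b"] that by simp
  \<comment> \<open>These deviations are truncated differences; \<open>upper\<close> and
    \<open>lower\<close> undo the truncation in \<open>Req\<close> and \<open>req\<close>.\<close>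
  have "\<forall>\<^sub>F k in sequentially. b * (k + a) - R (k + a) * a = b * k - R k * a"
  proof (rule eventually_periodic)
    fix k :: nat assume k: "1 \<le> k"
    show "b * (k + a) - R (k + a) * a \<le> b * k - R k * a"
      using mult_le_mono1[OF Rstep[OF k], of a] by (simp add: algebra_simps)
  qed
  moreover have "\<forall>\<^sub>F k in sequentially. b * r (k + b) - (k + b) * a = b * r k - k * a"
  proof (rule eventually_periodic)
    fix k :: nat assume k: "1 \<le> k"
    show "b * r (k + b) - (k + b) * a \<le> b * r k - k * a"
      using mult_le_mono2[OF rstep[OF k], of b] by (simp add: algebra_simps)
  qed
  ultimately have "\<forall>\<^sub>F k in sequentially. b * (k + a) - R (k + a) * a = b * k - R k * a \<and>
      b * r (k + b) - (k + b) * a = b * r k - k * a"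
    by (rule eventually_conj)
  then obtain K where K: "\<And>k. K \<le> k \<Longrightarrow> b * (k + a) - R (k + a) * a = b * k - R k * a"
      "\<And>k. K \<le> k \<Longrightarrow> b * r (k + b) - (k + b) * a = b * r k - k * a"
    unfolding eventually_sequentially by blast
  have Req: "R (k + a) = R k + b" if "K \<le> k" "1 \<le> k" for k
  proof -
    have "R (k + a) * a = (R k + b) * a"
      using K(1)[OF that(1)] upper[OF R(1)[OF that(2)] that(2)]
        upper[OF R(1)[of "k + a"]] that by (simp add: algebra_simps)
    with as(1) show ?thesis by simp
  qed
  have req: "r (k + b) = r k + a" if "K \<le> k" "1 \<le> k" for k
  proof -
    have "b * r (k + b) = b * (r k + a)"
      using K(2)[OF that(1)] lower[OF r(1)[OF that(2)] that(2)]
        lower[OF r(1)[of "k + b"]] that by (simp add: algebra_simps)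
    with as(1) show ?thesis by (simp add: b_def)
  qed
  have "is_AP \<delta> (U k)" if k: "K + a + b + 1 \<le> k" for k
  proof -
    have full: "z \<in> U k" if z: "z mod \<delta> = k mod \<delta>" "r k \<le> z" "z \<le> R k" for z
    proof (cases "k \<le> z")
      case True
      have R': "R k = R (k - a) + b" "1 \<le> k - a" using Req[of "k - a"] k by auto
      \<comment> \<open>With the first term in the index, the filling of \<open>U (k - a)\<close>
        from \<open>k - a\<close> to its maximum covers \<open>k\<close> to
        \<open>R k\<close>.\<close>
      have "z \<in> U (k - a + (a + 0 * \<delta>))"
        by (rule U_full[OF as(3) _ as(2) _ U_self R(1)])
           (use z R' True k in \<open>auto simp: b_def\<close>)
      then show ?thesis using k by simp
    next
      case False
      have r': "r k = r (k - b) + a" "1 \<le> k - b" using req[of "k - b"] k by auto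
      have "(k - b + a) mod \<delta> = (k - b + a + s * \<delta>) mod \<delta>" by simp
      also have "k - b + a + s * \<delta> = k" using k unfolding b_def by simp
      finally have z': "z mod \<delta> = (k - b + a) mod \<delta>" using z by simp
      \<comment> \<open>With the last term in the index, the filling of \<open>U (k - b)\<close>
        from its minimum to \<open>k - b\<close> covers \<open>r k\<close> to
        \<open>k\<close>.\<close>
      have "z \<in> U (k - b + (a + s * \<delta>))"
        by (rule U_full[OF as(3) _ as(2) _ r(1) U_self])
           (use z z' r' False k in \<open>auto simp: b_def\<close>)
      then show ?thesis using k by (simp add: b_def)
    qed
    have k1: "1 \<le> k" using k by simp
    have "x + \<delta> \<in> U k \<and> x + \<delta> \<le> y" if xy: "x \<in> U k" "y \<in> U k" "x < y" for x y
    proof -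
      have "x + \<delta> \<le> y" using U_less_imp[OF xy] .
      moreover have "x + \<delta> \<in> U k"
        using U_cong[OF xy(1)] r(2)[OF k1 xy(1)] R(2)[OF k1 xy(2)] \<open>x + \<delta> \<le> y\<close>
        by (intro full) auto
      ultimately show ?thesis by blast
    qed
    then show ?thesis unfolding is_AP_iff using delta_pos U_self[OF k1] by blast
  qed
  then show ?thesis unfolding eventually_sequentially by blast
qed

text \<open>Only \<open>k > l * q\<close> matters eventually; there \<open>k - l * q\<close> is not
  truncated and both unions are non-empty, so the interval takes its witness form.\<close>

lemma structure_theorem_iff:
  assumes "ladder l 1"
  shows "structure_theorem_for_unions \<L> \<longleftrightarrow>
    (\<exists>M::nat. \<forall>\<^sub>F k in sequentially.
       let I = U k \<inter>
                 int -` int_ivl (ereal_of_enat (fam_rho_at \<L> (k - l * q)) + ereal (real (l * q)))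
                                (ereal_of_enat (fam_rho_at \<L> k) - ereal (real M))
       in I = {} \<or> is_AP \<delta> I)" (is "_ \<longleftrightarrow> (\<exists>M. eventually (?P M) _)")
proof -
  let ?Q = "\<lambda>M k. let I = {x\<in>U k. (\<forall>v\<in>U (k - l * q). v + l * q \<le> x) \<and> (\<exists>v\<in>U k. x + M \<le> v)}
    in I = {} \<or> is_AP \<delta> I"
  have "?P M k \<longleftrightarrow> ?Q M k" if "l * q + 1 \<le> k" for M k
  proof -
    have "1 \<le> k" "1 \<le> k - l * q" using that by linarith+
    then have "U k \<noteq> {}" "U (k - l * q) \<noteq> {}" using U_self by blast+
    from fam_interval_eq[OF this] show ?thesis unfolding Let_def by (simp only:)
  qed
  then have "eventually (?P M) sequentially \<longleftrightarrow> eventually (?Q M) sequentially" for M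
    by (intro eventually_cong[OF eventually_ge_at_top[of "l * q + 1"]]) blast
  then show ?thesis
    using structure_theorem_imp[OF assms] imp_structure_theorem[OF assms] by blast
qed

end

theorem theorem2p2:
  fixes \<L> :: "nat set set" and \<delta> :: nat
  assumes "directed_family \<L>"
    and "finite (fam_distances \<L>)"
    and "fam_distances \<L> \<noteq> {}"
    and "\<delta> = Min (fam_distances \<L>)"
  shows
    "(\<forall>l::nat. (\<exists>L\<in>\<L>. {l, l + \<delta>} \<subseteq> L) \<longrightarrow>
        (\<exists>q::nat. real q = (1 / real \<delta>) * real (Max (fam_distances \<L>)) \<and>
          (structure_theorem_for_unions \<L> \<longleftrightarrow>
            (\<exists>M::nat. \<forall>\<^sub>F k in sequentially.
               let I = fam_union \<L> k \<inter>
                         int -` int_ivl (ereal_of_enat (fam_rho_at \<L> (k - l * q)) + ereal (real (l * q)))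
                                        (ereal_of_enat (fam_rho_at \<L> k) - ereal (real M))
               in I = {} \<or> is_AP \<delta> I))))
     \<and>
     (fam_elasticity \<L> < \<infinity> \<and>
        (\<exists>L\<in>\<L>. elasticity L = fam_elasticity \<L> \<and> is_AP \<delta> L) \<longrightarrow>
        (\<forall>\<^sub>F k in sequentially. is_AP \<delta> (fam_union \<L> k)))"
proof -
  interpret directed_family_finite_distances \<L> \<delta>
    using assms by unfold_locales
  have q: "real q = (1 / real \<delta>) * real (Max (fam_distances \<L>))"
    using delta_pos by (simp flip: q_delta)
  show ?thesis
  proof (intro conjI allI impI)
    fix l assume "\<exists>L\<in>\<L>. {l, l + \<delta>} \<subseteq> L"
    then have "ladder l 1" using ladder_oneI by blast
    from structure_theorem_iff[OF this] q
    show "\<exists>q::nat. real q = (1 / real \<delta>) * real (Max (fam_distances \<L>)) \<and>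
          (structure_theorem_for_unions \<L> \<longleftrightarrow>
            (\<exists>M::nat. \<forall>\<^sub>F k in sequentially.
               let I = fam_union \<L> k \<inter>
                         int -` int_ivl (ereal_of_enat (fam_rho_at \<L> (k - l * q)) + ereal (real (l * q)))
                                        (ereal_of_enat (fam_rho_at \<L> k) - ereal (real M))
               in I = {} \<or> is_AP \<delta> I))"
      by blast
  next
    assume "fam_elasticity \<L> < \<infinity> \<and>
        (\<exists>L\<in>\<L>. elasticity L = fam_elasticity \<L> \<and> is_AP \<delta> L)"
    then show "\<forall>\<^sub>F k in sequentially. is_AP \<delta> (fam_union \<L> k)"
      using accepted_elasticity_imp_AP by blast
  qed
qed

end
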